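(* Let $C$ be a bounded convex subset of a Banach space $X$ and let $x,y\in C$. Let $T:C\to C$ be a Cesaro equicontinuous affine function. The following assertions are equivalent: (i) $Ty=y$ and $y\in\overline{\mathrm{co}}\{T^nx : n\ge0\}$; (ii) $\frac1n\sum_{k=0}^{n-1}T^k(x)\to y$ in norm; (iii) $\frac1n\sum_{k=0}^{n-1}T^k(x)\to y$ weakly; (iv) the sequence $\left(\frac1n\sum_{k=0}^{n-1}T^k(x)\right)_{n\ge1}$ has a subsequence that converges weakly to $y$.
   Context: An affine function $T:C\to C$ on a convex set $C$ is Cesaro equicontinuous if the family of maps $\left\{\frac1n\sum_{k=0}^{n-1}T^k\right\}_{n\ge1}$ is equicontinuous on $C$ (for the norm). $\overline{\mathrm{co}}$ denotes the norm-closed convex hull in $X$. *)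

theory Defs
  imports "HOL-Analysis.Analysis"
begin

definition affine_map_on :: "'a::real_vector set \<Rightarrow> ('a \<Rightarrow> 'b::real_vector) \<Rightarrow> bool" where
  "affine_map_on C T \<longleftrightarrow>
    (\<forall>x\<in>C. \<forall>y\<in>C. \<forall>u\<ge>0. \<forall>v\<ge>0. u + v = 1 \<longrightarrow>
      T (u *\<^sub>R x + v *\<^sub>R y) = u *\<^sub>R T x + v *\<^sub>R T y)"

(* Pointwise equicontinuity relative to C: delta may depend on x but not on g. *)
definition equicontinuous_on ::
    "'a::metric_space set \<Rightarrow> ('a \<Rightarrow> 'b::metric_space) set \<Rightarrow> bool" where
  "equicontinuous_on C F \<longleftrightarrow>
    (\<forall>x\<in>C. \<forall>\<epsilon>>0. \<exists>\<delta>>0. \<forall>g\<in>F. \<forall>z\<in>C. dist z x < \<delta> \<longrightarrow> dist (g z) (g x) < \<epsilon>)"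

(* Meaningful for n > 0; the value at n = 0 is 0 and is never used below. *)
definition cesaro_mean :: "('a::real_vector \<Rightarrow> 'a) \<Rightarrow> nat \<Rightarrow> 'a \<Rightarrow> 'a" where
  "cesaro_mean T n x = (1 / real n) *\<^sub>R (\<Sum>k<n. (T ^^ k) x)"

definition cesaro_equicontinuous_on ::
    "'a::real_normed_vector set \<Rightarrow> ('a \<Rightarrow> 'a) \<Rightarrow> bool" where
  "cesaro_equicontinuous_on C T \<longleftrightarrow> equicontinuous_on C {cesaro_mean T n |n. 1 \<le> n}"

(* Over a complex space, testing with real functionals f is the same as testing with
   complex ones: Re and Im of a complex functional are real functionals, and every real
   functional is the real part of a complex one. *)
definition weakly_converges_to ::
    "(nat \<Rightarrow> 'a::real_normed_vector) \<Rightarrow> 'a \<Rightarrow> bool" where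
  "weakly_converges_to X l \<longleftrightarrow>
    (\<forall>f::'a \<Rightarrow> real. bounded_linear f \<longrightarrow> (\<lambda>n. f (X n)) \<longlonglongrightarrow> f l)"

end

theory Submission
  imports Defs
begin

text \<open>
  Mazur's theorem carries the step from weak convergence to the fixed point: the almost fixed
  points \<open>{z \<in> C. norm (T z - z) \<le> e}\<close> form a convex set that contains all late Cesaro means, so
  the weak cluster point \<open>y\<close> is in its norm closure, for every \<open>e > 0\<close>, and \<open>T\<close> is norm continuous
  because its second Cesaro mean is. Conversely, the points of \<open>C\<close> whose Cesaro means are
  asymptotic to those of \<open>x\<close> form a convex set invariant under \<open>T\<close>, so some of them are close to
  \<open>y\<close>, and equicontinuity at \<open>y\<close> transfers this to the Cesaro means of \<open>x\<close>.
\<close>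

section \<open>Sublinear functionals and the Hahn-Banach theorem\<close>

definition sublinear :: "('a::real_vector \<Rightarrow> real) \<Rightarrow> bool" where
  "sublinear p \<longleftrightarrow>
    (\<forall>x y. p (x + y) \<le> p x + p y) \<and> (\<forall>c\<ge>0. \<forall>x. p (c *\<^sub>R x) = c * p x)"

lemma sublinear_add: "sublinear p \<Longrightarrow> p (x + y) \<le> p x + p y"
  by (simp add: sublinear_def)

lemma sublinear_scale: "sublinear p \<Longrightarrow> 0 \<le> c \<Longrightarrow> p (c *\<^sub>R x) = c * p x"
  by (simp add: sublinear_def)

lemma sublinear_zero: "sublinear p \<Longrightarrow> p 0 = 0"
  using sublinear_scale[of p 0 0] by simp

lemma sublinear_minus_le: "sublinear p \<Longrightarrow> - p (- x) \<le> p x"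
  using sublinear_add[of p x "- x"] sublinear_zero[of p] by simp

text \<open>The inequality at \<open>1 / c\<close> and \<open>c *\<^sub>R x\<close> gives its own
  converse, so a functional defined as an infimum needs only an upper bound on
  \<open>p (c *\<^sub>R x)\<close>.\<close>

lemma sublinearI:
  assumes add: "\<And>x y. p (x + y) \<le> p x + p y"
    and scale: "\<And>c x. 0 < c \<Longrightarrow> p (c *\<^sub>R x) \<le> c * p x"
    and zero: "p 0 = 0"
  shows "sublinear p"
proof -
  have "p (c *\<^sub>R x) = c * p x" if "0 \<le> c" for c x
  proof (cases "c = 0")
    case False
    with that have c: "0 < c" by simp
    have "p x \<le> (1 / c) * p (c *\<^sub>R x)"
      using scale[of "1 / c" "c *\<^sub>R x"] c by simp
    then have "c * p x \<le> p (c *\<^sub>R x)"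
      using c by (simp add: field_simps)
    with scale[OF c] show ?thesis by (simp add: antisym)
  qed (simp add: zero)
  with add show ?thesis by (simp add: sublinear_def)
qed

lemma sublinear_norm: "sublinear (norm :: 'a::real_normed_vector \<Rightarrow> real)"
  by (simp add: sublinear_def norm_triangle_ineq)

text \<open>Supplies the bounds for Zorn's lemma. The chain matters for subadditivity: a
  \<open>q\<close> used at \<open>x\<close> and an \<open>r\<close> used at \<open>y\<close> can
  both be replaced by the smaller of the two.\<close>

lemma sublinear_Inf_chain:
  assumes sub: "\<And>q. q \<in> Q \<Longrightarrow> sublinear q"
    and ne: "Q \<noteq> {}"
    and bd: "\<And>x. bdd_below ((\<lambda>q. q x) ` Q)"
    and chain: "\<And>q r. q \<in> Q \<Longrightarrow> r \<in> Q \<Longrightarrow> q \<le> r \<or> r \<le> q"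
  shows "sublinear (\<lambda>x. INF q\<in>Q. q x)"
proof (rule sublinearI)
  fix x y
  have "(INF q\<in>Q. q (x + y)) \<le> q x + r y" if qr: "q \<in> Q" "r \<in> Q" for q r
  proof -
    obtain s where s: "s \<in> Q" "s \<le> q" "s \<le> r"
      using chain[OF qr] qr by auto
    have "(INF q\<in>Q. q (x + y)) \<le> s (x + y)" by (rule cINF_lower[OF bd s(1)])
    also have "\<dots> \<le> s x + s y" by (rule sublinear_add[OF sub[OF s(1)]])
    also have "\<dots> \<le> q x + r y" using s by (simp add: le_fun_def add_mono)
    finally show ?thesis .
  qed
  then have "(INF q\<in>Q. q (x + y)) - r y \<le> (INF q\<in>Q. q x)" if "r \<in> Q" for r
    using that ne by (intro cINF_greatest) (auto simp: algebra_simps)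
  then have "(INF q\<in>Q. q (x + y)) - (INF q\<in>Q. q x) \<le> (INF r\<in>Q. r y)"
    using ne by (intro cINF_greatest) (auto simp: algebra_simps)
  then show "(INF q\<in>Q. q (x + y)) \<le> (INF q\<in>Q. q x) + (INF q\<in>Q. q y)" by simp
next
  fix c :: real and x assume c: "0 < c"
  have "(INF q\<in>Q. q (c *\<^sub>R x)) / c \<le> q x" if "q \<in> Q" for q
    using cINF_lower[OF bd that, of "c *\<^sub>R x"] sublinear_scale[OF sub[OF that], of c x] c
    by (simp add: field_simps)
  then have "(INF q\<in>Q. q (c *\<^sub>R x)) / c \<le> (INF q\<in>Q. q x)"
    using ne by (intro cINF_greatest)
  then show "(INF q\<in>Q. q (c *\<^sub>R x)) \<le> c * (INF q\<in>Q. q x)"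
    using c by (simp add: field_simps)
next
  show "(INF q\<in>Q. q 0) = 0" using ne sub by (simp add: sublinear_zero)
qed

text \<open>
  The witness is \<open>q x = inf {p (x + t k) - t d | t \<ge> 0, k \<in> K}\<close>. It is used twice: with \<open>K\<close> a
  singleton it shows that minimal sublinear functionals are linear, and with \<open>p\<close> the norm it
  separates \<open>K\<close> from \<open>0\<close>.
\<close>
lemma sublinear_reduce:
  fixes K :: "'a::real_vector set"
  assumes p: "sublinear p" and K: "convex K" "K \<noteq> {}" and d: "\<And>k. k \<in> K \<Longrightarrow> d \<le> p k"
  obtains q where "sublinear q" "q \<le> p" "\<And>k. k \<in> K \<Longrightarrow> q (- k) \<le> - d"
proof -
  define I where "I = {0::real..} \<times> K"
  define g where "g x = (\<lambda>(t, k). p (x + t *\<^sub>R k) - t * d)" for x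
  define q where "q x = (INF i\<in>I. g x i)" for x
  have ne: "I \<noteq> {}" using K by (auto simp: I_def)
  \<comment> \<open>The hypothesis on \<open>d\<close> enters here: the bound is free of
    \<open>t\<close> and \<open>k\<close>, so the infimum \<open>q x\<close> is finite.\<close>
  have lower: "- p (- x) \<le> g x i" if iI: "i \<in> I" for x i
  proof -
    obtain t k where i: "i = (t, k)" "0 \<le> t" "k \<in> K" using iI by (auto simp: I_def)
    have "p (t *\<^sub>R k) \<le> p (x + t *\<^sub>R k) + p (- x)"
      using sublinear_add[OF p, of "x + t *\<^sub>R k" "- x"] by simp
    moreover have "t * d \<le> p (t *\<^sub>R k)"
      using i d[of k] by (simp add: sublinear_scale[OF p] mult_left_mono)
    ultimately show ?thesis by (simp add: g_def i)
  qed
  then have bd: "bdd_below (g x ` I)" for x by (intro bdd_belowI2)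
  have upper: "q x \<le> p (x + t *\<^sub>R k) - t * d" if "0 \<le> t" "k \<in> K" for x t k
    unfolding q_def using cINF_lower[OF bd, of "(t, k)" x] that by (simp add: I_def g_def)
  have le: "q x \<le> p x" for x
    using upper[of 0 _ x] K by auto
  have comb: "q (x + y) \<le> g x i + g y j" if ij: "i \<in> I" "j \<in> I" for x y i j
  proof -
    obtain s k where i: "i = (s, k)" "0 \<le> s" "k \<in> K" using ij(1) by (auto simp: I_def)
    obtain t l where j: "j = (t, l)" "0 \<le> t" "l \<in> K" using ij(2) by (auto simp: I_def)
    \<comment> \<open>The weighted mean of \<open>k\<close> and \<open>l\<close> makes
      \<open>(s + t, m)\<close> an index for \<open>x + y\<close>; if both weights vanish, any point
      of \<open>K\<close> will do.\<close>
    obtain m where m: "m \<in> K" "(s + t) *\<^sub>R m = s *\<^sub>R k + t *\<^sub>R l"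
    proof (cases "s + t = 0")
      case True
      with i j have "s = 0" "t = 0" by auto
      with i that show ?thesis by auto
    next
      case False
      define m where "m = (s / (s + t)) *\<^sub>R k + (t / (s + t)) *\<^sub>R l"
      have "m \<in> K" unfolding m_def
        using i j False by (intro convexD[OF K(1)]) (auto simp flip: add_divide_distrib)
      moreover have "(s + t) *\<^sub>R m = s *\<^sub>R k + t *\<^sub>R l"
        using False by (simp add: m_def scaleR_add_right)
      ultimately show ?thesis using that by blast
    qed
    have "q (x + y) \<le> p ((x + s *\<^sub>R k) + (y + t *\<^sub>R l)) - (s + t) * d"
      using upper[of "s + t" m "x + y"] i j m by (simp add: algebra_simps)
    also have "\<dots> \<le> g x i + g y j"
      using sublinear_add[OF p, of "x + s *\<^sub>R k" "y + t *\<^sub>R l"]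
      by (simp add: g_def i j algebra_simps)
    finally show ?thesis .
  qed
  have "sublinear q"
  proof (rule sublinearI)
    fix x y
    have "q (x + y) - g y j \<le> q x" if "j \<in> I" for j
      unfolding q_def[of x] using comb[OF _ that, of _ x y] ne
      by (intro cINF_greatest) (auto simp: diff_le_eq)
    then have "q (x + y) - q x \<le> q y"
      unfolding q_def[of y] using ne by (intro cINF_greatest) (auto simp: algebra_simps)
    then show "q (x + y) \<le> q x + q y" by simp
  next
    fix c :: real and x assume c: "0 < c"
    \<comment> \<open>The index \<open>(c * t, k)\<close> at \<open>c *\<^sub>R x\<close>
      corresponds to \<open>(t, k)\<close> at \<open>x\<close>.\<close>
    have "q (c *\<^sub>R x) / c \<le> g x i" if iI: "i \<in> I" for i
    proof -
      obtain t k where i: "i = (t, k)" "0 \<le> t" "k \<in> K" using iI by (auto simp: I_def)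
      have "q (c *\<^sub>R x) \<le> p (c *\<^sub>R (x + t *\<^sub>R k)) - c * t * d"
        using upper[of "c * t" k "c *\<^sub>R x"] i c by (simp add: scaleR_add_right)
      also have "\<dots> = c * g x i"
        using c sublinear_scale[OF p, of c "x + t *\<^sub>R k"] by (simp add: g_def i algebra_simps)
      finally show ?thesis using c by (simp add: field_simps)
    qed
    then have "q (c *\<^sub>R x) / c \<le> q x"
      unfolding q_def[of x] using ne by (intro cINF_greatest)
    then show "q (c *\<^sub>R x) \<le> c * q x" using c by (simp add: field_simps)
  next
    have "0 \<le> q 0" unfolding q_def
      using ne lower[of _ 0] by (intro cINF_greatest) (auto simp: sublinear_zero[OF p])
    with le[of 0] show "q 0 = 0" by (simp add: sublinear_zero[OF p])
  qed
  moreover have "q (- k) \<le> - d" if "k \<in> K" for k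
    using upper[of 1 k "- k"] that by (simp add: sublinear_zero[OF p])
  ultimately show ?thesis using that le by (simp add: le_fun_def)
qed

text \<open>Reducing \<open>p\<close> along the single point \<open>y\<close> at level
  \<open>p y\<close> changes nothing, by minimality, so \<open>p (- y) \<le> - p y\<close>. Hence
  \<open>p\<close> is odd, and an odd sublinear functional is linear.\<close>

lemma minimal_sublinear_linear:
  assumes p: "sublinear p" and min: "\<And>q. sublinear q \<Longrightarrow> q \<le> p \<Longrightarrow> q = p"
  shows "linear p"
proof -
  have neg: "p (- y) = - p y" for y
  proof -
    obtain q where q: "sublinear q" "q \<le> p" "q (- y) \<le> - p y"
      using sublinear_reduce[OF p, of "{y}" "p y"] by auto
    with min[OF q(1,2)] sublinear_minus_le[OF p, of y] show ?thesis by simp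
  qed
  have add: "p (x + y) = p x + p y" for x y
    using sublinear_add[OF p, of x y] sublinear_add[OF p, of "x + y" "- y"] by (simp add: neg)
  have "p (c *\<^sub>R x) = c * p x" for c x
  proof (cases "0 \<le> c")
    case False
    then show ?thesis
      using sublinear_scale[OF p, of "- c" x] neg[of "c *\<^sub>R x"] by simp
  qed (simp add: sublinear_scale[OF p])
  with add show ?thesis by (intro linearI) auto
qed

text \<open>Zorn's lemma is applied to the sublinear functionals below \<open>p\<close> rather than
  to partial linear extensions; a minimal one is linear.\<close>

theorem Hahn_Banach_sublinear:
  assumes p: "sublinear p"
  obtains f where "linear f" "f \<le> p"
proof -
  define A where "A = {q. sublinear q \<and> q \<le> p}"
  \<comment> \<open>The order is reversed so that the maximal element from Zorn's lemma is a minimal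
    functional.\<close>
  have po: "partial_order_on A (relation_of (\<ge>) A)"
    by (rule partial_order_on_relation_ofI) auto
  have chains: "\<exists>u\<in>A. \<forall>q\<in>Q. u \<le> q" if "Q \<in> Chains (relation_of (\<ge>) A)" for Q
  proof (cases "Q = {}")
    case True
    then show ?thesis using p by (auto simp: A_def)
  next
    case False
    have QA: "q \<in> A" if "q \<in> Q" for q
      using \<open>Q \<in> _\<close> that by (auto simp: Chains_def relation_of_def)
    have chain: "q \<le> r \<or> r \<le> q" if "q \<in> Q" "r \<in> Q" for q r
      using \<open>Q \<in> _\<close> that by (auto simp: Chains_def relation_of_def)
    \<comment> \<open>Every sublinear \<open>q\<close> below \<open>p\<close> satisfies
      \<open>- p (- x) \<le> - q (- x) \<le> q x\<close>.\<close>
    have bd: "bdd_below ((\<lambda>q. q x) ` Q)" for x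
    proof (rule bdd_belowI2)
      fix q assume "q \<in> Q"
      then have "sublinear q" "q (- x) \<le> p (- x)" using QA by (auto simp: A_def le_fun_def)
      with sublinear_minus_le[of q x] show "- p (- x) \<le> q x" by simp
    qed
    define u where "u x = (INF q\<in>Q. q x)" for x
    have le: "u \<le> q" if "q \<in> Q" for q
      unfolding u_def le_fun_def using cINF_lower[OF bd that] by simp
    have "sublinear u"
      unfolding u_def using QA False bd chain
      by (intro sublinear_Inf_chain) (auto simp: A_def)
    moreover have "u \<le> p"
      using le QA False by (fastforce simp: A_def intro: order_trans)
    ultimately show ?thesis using le by (auto simp: A_def)
  qed
  obtain f where f: "f \<in> A" "\<And>q. q \<in> A \<Longrightarrow> q \<le> f \<Longrightarrow> q = f"
    using predicate_Zorn[OF po] chains by auto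
  have "linear f"
  proof (rule minimal_sublinear_linear)
    show "q = f" if "sublinear q" "q \<le> f" for q
      using that f by (auto simp: A_def intro: order_trans)
  qed (use f in \<open>simp add: A_def\<close>)
  then show ?thesis using that f(1) by (simp add: A_def)
qed

section \<open>Separation of convex sets and Mazur's theorem\<close>

lemma separate_convex_from_zero:
  fixes K :: "'a::real_normed_vector set"
  assumes "convex K" "K \<noteq> {}" and d: "\<And>k. k \<in> K \<Longrightarrow> d \<le> norm k"
  obtains f :: "'a \<Rightarrow> real" where "bounded_linear f" "\<And>k. k \<in> K \<Longrightarrow> d \<le> f k"
proof -
  \<comment> \<open>Lowering the norm to \<open>q\<close> first builds the separation into the upper
    bound: a linear \<open>f \<le> q\<close> has \<open>f (- k) \<le> - d\<close>, and
    \<open>f \<le> norm\<close> makes it bounded with constant 1.\<close>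
  obtain q where q: "sublinear q" "q \<le> norm" "\<And>k. k \<in> K \<Longrightarrow> q (- k) \<le> - d"
    using sublinear_reduce[OF sublinear_norm assms] by blast
  obtain f where f: "linear f" "f \<le> q"
    using Hahn_Banach_sublinear[OF q(1)] by blast
  have le: "f x \<le> norm x" for x
    using f(2) q(2) by (auto simp: le_fun_def intro: order_trans)
  have neg: "f (- x) = - f x" for x
    by (rule linear_neg[OF f(1)])
  have "bounded_linear f"
  proof (rule bounded_linear_intro[where K = 1])
    show "norm (f x) \<le> norm x * 1" for x
      using le[of x] le[of "- x"] by (simp add: neg)
  qed (simp_all add: linear_add[OF f(1)] linear_scale[OF f(1)])
  moreover have "d \<le> f k" if "k \<in> K" for k
    using q(3)[OF that] f(2) neg[of k] by (auto simp: le_fun_def dest: spec[of _ "- k"])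
  ultimately show ?thesis using that by blast
qed

text \<open>If \<open>l\<close> had distance at least \<open>d > 0\<close> from \<open>K\<close>,
  some bounded functional would exceed its value at \<open>l\<close> by \<open>d\<close> on all of
  \<open>K\<close>, which weak convergence excludes.\<close>

theorem Mazur_weak_limit_in_closure:
  fixes K :: "'a::real_normed_vector set"
  assumes K: "convex K" and ev: "eventually (\<lambda>n. X n \<in> K) sequentially"
    and lim: "weakly_converges_to X l"
  shows "l \<in> closure K"
proof (rule ccontr)
  assume "l \<notin> closure K"
  then obtain d where d: "0 < d" "\<And>k. k \<in> K \<Longrightarrow> d \<le> dist k l"
    by (auto simp: closure_approachable not_less)
  have ne: "K \<noteq> {}" using ev by (auto simp: eventually_sequentially)
  define L where "L = (\<lambda>k. k - l) ` K"
  have "convex L" "L \<noteq> {}" "\<And>k. k \<in> L \<Longrightarrow> d \<le> norm k"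
    using K ne d(2) by (auto simp: L_def convex_translation_subtract dist_norm)
  then obtain f :: "'a \<Rightarrow> real" where f: "bounded_linear f" "\<And>k. k \<in> L \<Longrightarrow> d \<le> f k"
    using separate_convex_from_zero by blast
  have "(\<lambda>n. f (X n)) \<longlonglongrightarrow> f l" using lim f(1) by (simp add: weakly_converges_to_def)
  moreover have "f l + d \<le> f k" if "k \<in> K" for k
    using f(2)[of "k - l"] that linear_diff[OF bounded_linear.linear[OF f(1)], of k l]
    by (simp add: L_def)
  then have "eventually (\<lambda>n. f l + d \<le> f (X n)) sequentially"
    using ev by (auto elim: eventually_mono)
  ultimately have "f l + d \<le> f l"
    by (intro tendsto_lowerbound[where F = sequentially]) auto
  with d(1) show False by simp
qed

section \<open>Cesaro means of affine maps\<close>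

lemma affine_map_onD:
  assumes "affine_map_on C T" "x \<in> C" "y \<in> C" "0 \<le> u" "0 \<le> v" "u + v = 1"
  shows "T (u *\<^sub>R x + v *\<^sub>R y) = u *\<^sub>R T x + v *\<^sub>R T y"
  using assms by (auto simp: affine_map_on_def)

lemma funpow_mem: "T \<in> C \<rightarrow> C \<Longrightarrow> x \<in> C \<Longrightarrow> (T ^^ n) x \<in> C"
  by (induction n) auto

lemma affine_map_on_funpow:
  assumes "affine_map_on C T" "T \<in> C \<rightarrow> C"
  shows "affine_map_on C (T ^^ n)"
proof (induction n)
  case (Suc n)
  then show ?case
    using assms funpow_mem[OF assms(2)] by (simp add: affine_map_on_def)
qed (simp add: affine_map_on_def)

lemma affine_map_on_cesaro_mean:
  assumes "affine_map_on C T" "T \<in> C \<rightarrow> C"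
  shows "affine_map_on C (cesaro_mean T n)"
  using affine_map_on_funpow[OF assms]
  by (simp add: affine_map_on_def cesaro_mean_def sum.distrib scaleR_add_right
      scaleR_sum_right[symmetric] scaleR_left_commute)

text \<open>A convex combination of two points, the form in which \<open>affine_map_on\<close>
  applies in an induction on \<open>n\<close>.\<close>

lemma cesaro_mean_Suc:
  assumes "0 < n"
  shows "cesaro_mean T (Suc n) x =
    (real n / real (Suc n)) *\<^sub>R cesaro_mean T n x + (1 / real (Suc n)) *\<^sub>R (T ^^ n) x"
  using assms by (simp add: cesaro_mean_def scaleR_add_right)

text \<open>Asking only for the orbit of \<open>x\<close> to lie in \<open>C\<close> lets
  \<open>C\<close> also be the convex hull of that orbit.\<close>

lemma cesaro_mean_mem:
  assumes "convex C" "\<And>k. (T ^^ k) x \<in> C" "0 < n"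
  shows "cesaro_mean T n x \<in> C"
  using assms unfolding cesaro_mean_def scaleR_sum_right by (intro convex_sum) auto

lemma cesaro_mean_fixed: "T y = y \<Longrightarrow> 0 < n \<Longrightarrow> cesaro_mean T n y = y"
proof -
  assume "T y = y" "0 < n"
  moreover from this have "(T ^^ k) y = y" for k by (induction k) auto
  ultimately show ?thesis by (simp add: cesaro_mean_def sum_constant_scaleR)
qed

lemma cesaro_mean_shift:
  "cesaro_mean T n (T x) - cesaro_mean T n x = (1 / real n) *\<^sub>R ((T ^^ n) x - x)"
proof -
  have "(\<Sum>k<n. (T ^^ k) (T x)) - (\<Sum>k<n. (T ^^ k) x) = (\<Sum>k<n. (T ^^ Suc k) x - (T ^^ k) x)"
    by (simp add: sum_subtractf funpow_swap1)
  also have "\<dots> = (T ^^ n) x - x"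
    by (subst sum_lessThan_telescope) simp
  finally show ?thesis
    by (simp add: cesaro_mean_def flip: scaleR_diff_right)
qed

lemma affine_cesaro_mean_commute:
  assumes "convex C" "affine_map_on C T" "T \<in> C \<rightarrow> C" "x \<in> C" "0 < n"
  shows "T (cesaro_mean T n x) = cesaro_mean T n (T x)"
  using assms(5)
\<comment> \<open>The induction starts at 1: the mean of length 0 is the default value 0, which
  \<open>T\<close> need not fix.\<close>
proof (induction n rule: nat_induct_non_zero)
  case 1
  then show ?case by (simp add: cesaro_mean_def)
next
  case (Suc n)
  have "T (cesaro_mean T (Suc n) x) = (real n / real (Suc n)) *\<^sub>R T (cesaro_mean T n x)
      + (1 / real (Suc n)) *\<^sub>R T ((T ^^ n) x)"
    unfolding cesaro_mean_Suc[OF Suc.hyps]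
    using assms Suc.hyps
    by (intro affine_map_onD[OF assms(2)] cesaro_mean_mem funpow_mem)
      (auto simp: field_simps)
  then show ?case
    by (simp add: Suc.IH cesaro_mean_Suc[OF Suc.hyps] funpow_swap1)
qed

text \<open>Only the two ends of the telescoping sum remain, each of norm at most
  \<open>M\<close>.\<close>

lemma cesaro_mean_shift_norm_le:
  assumes "\<And>z. z \<in> C \<Longrightarrow> norm z \<le> M" "T \<in> C \<rightarrow> C" "x \<in> C"
  shows "norm (cesaro_mean T n (T x) - cesaro_mean T n x) \<le> 2 * M / real n"
proof -
  have "norm ((T ^^ n) x - x) \<le> 2 * M"
    using norm_triangle_ineq4[of "(T ^^ n) x" x] assms(1)[OF assms(3)]
      assms(1)[OF funpow_mem[OF assms(2,3)], of n] by simp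
  then show ?thesis
    by (simp add: cesaro_mean_shift divide_right_mono)
qed

text \<open>The mean of length 2 is half of \<open>z + T z\<close>, which can be solved for
  \<open>T z\<close>.\<close>

lemma cesaro_equicontinuous_on_imp_continuous_on:
  assumes "cesaro_equicontinuous_on C T"
  shows "continuous_on C T"
proof -
  have "cesaro_mean T 2 \<in> {cesaro_mean T n |n. 1 \<le> n}" by force
  with assms have "continuous_on C (cesaro_mean T 2)"
    unfolding cesaro_equicontinuous_on_def equicontinuous_on_def continuous_on_iff by meson
  then have "continuous_on C (\<lambda>z. 2 *\<^sub>R cesaro_mean T 2 z - z)"
    by (intro continuous_intros)
  moreover have "2 *\<^sub>R cesaro_mean T 2 z - z = T z" for z
    by (simp add: cesaro_mean_def numeral_2_eq_2)
  ultimately show ?thesis by simp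
qed

section \<open>Limits of Cesaro means and fixed points\<close>

lemma cesaro_mean_asymptotic_on_convex_hull:
  fixes T :: "'a::real_normed_vector \<Rightarrow> 'a"
  assumes "bounded C" "convex C" "T \<in> C \<rightarrow> C" "affine_map_on C T" "x \<in> C"
    and "z \<in> convex hull range (\<lambda>n. (T ^^ n) x)"
  shows "(\<lambda>n. cesaro_mean T n z - cesaro_mean T n x) \<longlonglongrightarrow> 0"
proof -
  \<comment> \<open>It suffices that \<open>S\<close> is convex and contains the orbit of
    \<open>x\<close>. Keeping \<open>S\<close> inside \<open>C\<close> gives access to the shift
    bound and to affinity.\<close>
  define S where "S = {z \<in> C. (\<lambda>n. cesaro_mean T n z - cesaro_mean T n x) \<longlonglongrightarrow> 0}"
  obtain M where M: "\<And>z. z \<in> C \<Longrightarrow> norm z \<le> M"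
    using \<open>bounded C\<close> by (auto simp: bounded_iff)
  have invariant: "T z \<in> S" if "z \<in> S" for z
  proof -
    have z: "z \<in> C" "(\<lambda>n. cesaro_mean T n z - cesaro_mean T n x) \<longlonglongrightarrow> 0"
      using that by (auto simp: S_def)
    have "(\<lambda>n. cesaro_mean T n (T z) - cesaro_mean T n z) \<longlonglongrightarrow> 0"
    proof (rule Lim_null_comparison)
      show "\<forall>\<^sub>F n in sequentially.
          norm (cesaro_mean T n (T z) - cesaro_mean T n z) \<le> 2 * M / real n"
        using cesaro_mean_shift_norm_le[OF M \<open>T \<in> C \<rightarrow> C\<close> z(1)] by auto
    qed (rule lim_const_over_n)
    from tendsto_add[OF this z(2)] show ?thesis
      using z(1) \<open>T \<in> C \<rightarrow> C\<close> by (auto simp: S_def)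
  qed
  have "(T ^^ k) x \<in> S" for k
    by (induction k) (auto simp: invariant, simp add: S_def \<open>x \<in> C\<close>)
  moreover have "convex S"
  proof (rule convexI)
    fix a b and u v :: real
    assume ab: "a \<in> S" "b \<in> S" and uv: "0 \<le> u" "0 \<le> v" "u + v = 1"
    have "(\<lambda>n. u *\<^sub>R (cesaro_mean T n a - cesaro_mean T n x)
        + v *\<^sub>R (cesaro_mean T n b - cesaro_mean T n x)) \<longlonglongrightarrow> u *\<^sub>R 0 + v *\<^sub>R 0"
      using ab by (intro tendsto_intros) (auto simp: S_def)
    moreover have "u *\<^sub>R (cesaro_mean T n a - cesaro_mean T n x)
        + v *\<^sub>R (cesaro_mean T n b - cesaro_mean T n x)
      = cesaro_mean T n (u *\<^sub>R a + v *\<^sub>R b) - cesaro_mean T n x" for n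
    proof -
      have "cesaro_mean T n (u *\<^sub>R a + v *\<^sub>R b) = u *\<^sub>R cesaro_mean T n a + v *\<^sub>R cesaro_mean T n b"
        using affine_map_onD[OF affine_map_on_cesaro_mean[OF assms(4,3)]] ab uv
        by (auto simp: S_def)
      moreover have "u *\<^sub>R cesaro_mean T n x + v *\<^sub>R cesaro_mean T n x = cesaro_mean T n x"
        using uv(3) by (simp flip: scaleR_add_left)
      ultimately show ?thesis by (simp add: algebra_simps)
    qed
    ultimately show "u *\<^sub>R a + v *\<^sub>R b \<in> S"
      using ab uv convexD[OF \<open>convex C\<close>] by (auto simp: S_def)
  qed
  ultimately have "convex hull range (\<lambda>n. (T ^^ n) x) \<subseteq> S"
    by (intro hull_minimal) auto
  with assms(6) show ?thesis by (auto simp: S_def)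
qed

lemma cesaro_mean_converges_to_fixed_point:
  fixes T :: "'a::real_normed_vector \<Rightarrow> 'a"
  assumes "bounded C" "convex C" "x \<in> C" "y \<in> C" "T \<in> C \<rightarrow> C" "affine_map_on C T"
    and equi: "cesaro_equicontinuous_on C T"
    and y: "T y = y" "y \<in> closure (convex hull range (\<lambda>n. (T ^^ n) x))"
  shows "(\<lambda>n. cesaro_mean T (Suc n) x) \<longlonglongrightarrow> y"
proof (rule metric_LIMSEQ_I)
  fix e :: real assume "0 < e"
  then have "0 < e / 2" by simp
  \<comment> \<open>Equicontinuity gives one \<open>d\<close> for all \<open>n\<close>, so
    \<open>z\<close> can be fixed before \<open>n\<close>; the means of \<open>y\<close> are
    \<open>y\<close> itself.\<close>
  then obtain d where d: "0 < d"
    "\<And>n z. 1 \<le> n \<Longrightarrow> z \<in> C \<Longrightarrow> dist z y < d \<Longrightarrow>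
      dist (cesaro_mean T n z) (cesaro_mean T n y) < e / 2"
    using equi \<open>y \<in> C\<close>
    unfolding cesaro_equicontinuous_on_def equicontinuous_on_def by blast
  obtain z where z: "z \<in> convex hull range (\<lambda>n. (T ^^ n) x)" "dist z y < d"
    using y(2) d(1) by (auto simp: closure_approachable)
  have "convex hull range (\<lambda>n. (T ^^ n) x) \<subseteq> C"
    using assms(2) funpow_mem[OF assms(5,3)] by (intro hull_minimal) auto
  with z have "z \<in> C" by auto
  obtain N where N: "\<And>n. N \<le> n \<Longrightarrow> norm (cesaro_mean T n z - cesaro_mean T n x) < e / 2"
    using LIMSEQ_D[OF cesaro_mean_asymptotic_on_convex_hull[OF assms(1,2,5,6,3) z(1)] \<open>0 < e / 2\<close>]
    by auto
  have "dist (cesaro_mean T (Suc n) x) y < e" if "N \<le> n" for n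
  proof -
    have "dist (cesaro_mean T (Suc n) z) y < e / 2"
      using d(2)[OF _ \<open>z \<in> C\<close> z(2), of "Suc n"] by (simp add: cesaro_mean_fixed y(1))
    moreover have "dist (cesaro_mean T (Suc n) z) (cesaro_mean T (Suc n) x) < e / 2"
      using N[of "Suc n"] that by (simp add: dist_norm)
    ultimately show ?thesis by (metis dist_commute dist_triangle_half_r)
  qed
  then show "\<exists>N. \<forall>n\<ge>N. dist (cesaro_mean T (Suc n) x) y < e" by blast
qed

lemma weak_cluster_point_of_cesaro_means_fixed:
  fixes T :: "'a::real_normed_vector \<Rightarrow> 'a"
  assumes "bounded C" "convex C" "x \<in> C" "y \<in> C" "T \<in> C \<rightarrow> C" "affine_map_on C T"
    and equi: "cesaro_equicontinuous_on C T"
    and r: "strict_mono r" and weak: "weakly_converges_to (\<lambda>n. cesaro_mean T (Suc (r n)) x) y"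
  shows "T y = y"
proof -
  obtain M where M: "\<And>z. z \<in> C \<Longrightarrow> norm z \<le> M"
    using \<open>bounded C\<close> by (auto simp: bounded_iff)
  have "norm (T y - y) \<le> e" if "0 < e" for e
  proof -
    define K where "K = {z \<in> C. norm (T z - z) \<le> e}"
    \<comment> \<open>\<open>T z - z\<close> is affine in \<open>z\<close> and the norm is
      convex.\<close>
    have "convex K"
    proof (rule convexI)
      fix a b and u v :: real
      assume ab: "a \<in> K" "b \<in> K" and uv: "0 \<le> u" "0 \<le> v" "u + v = 1"
      have "T (u *\<^sub>R a + v *\<^sub>R b) - (u *\<^sub>R a + v *\<^sub>R b) = u *\<^sub>R (T a - a) + v *\<^sub>R (T b - b)"
        using affine_map_onD[OF assms(6)] ab uv by (simp add: K_def algebra_simps)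
      also have "norm \<dots> \<le> u * norm (T a - a) + v * norm (T b - b)"
        using uv norm_triangle_ineq[of "u *\<^sub>R (T a - a)" "v *\<^sub>R (T b - b)"] by simp
      also have "\<dots> \<le> e"
        using ab uv by (intro convex_bound_le) (auto simp: K_def)
      finally show "u *\<^sub>R a + v *\<^sub>R b \<in> K"
        using ab uv convexD[OF \<open>convex C\<close>] by (auto simp: K_def)
    qed
    moreover have "\<forall>\<^sub>F n in sequentially. cesaro_mean T (Suc (r n)) x \<in> K"
    proof -
      have "\<forall>\<^sub>F n in sequentially. 2 * M / real n < e"
        using lim_const_over_n[of "2 * M"] that by (rule order_tendstoD)
      then obtain N where N: "\<And>n. N \<le> n \<Longrightarrow> 2 * M / real n < e"
        by (auto simp: eventually_sequentially)
      have "cesaro_mean T (Suc (r n)) x \<in> K" if "N \<le> n" for n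
      proof -
        \<comment> \<open>A strictly increasing \<open>r\<close> satisfies
          \<open>n \<le> r n\<close>, so late terms of the subsequence are late means.\<close>
        have "N \<le> Suc (r n)" using that seq_suble[OF r, of n] by simp
        from N[OF this] have "norm (T (cesaro_mean T (Suc (r n)) x) - cesaro_mean T (Suc (r n)) x) \<le> e"
          using cesaro_mean_shift_norm_le[OF M assms(5,3), of "Suc (r n)"]
          by (simp add: affine_cesaro_mean_commute[OF assms(2,6,5,3)])
        then show ?thesis
          using cesaro_mean_mem[OF assms(2) funpow_mem[OF assms(5,3)], of "Suc (r n)"]
          by (simp add: K_def)
      qed
      then show ?thesis by (auto simp: eventually_sequentially)
    qed
    ultimately have "y \<in> closure K"
      using weak by (rule Mazur_weak_limit_in_closure)
    \<comment> \<open>\<open>C\<close> need not be closed, so the bound is carried to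
      \<open>y\<close> along a sequence in \<open>K\<close>, by continuity of \<open>T\<close> on
      \<open>C\<close> at \<open>y \<in> C\<close>.\<close>
    then obtain s where s: "\<And>n. s n \<in> K" "s \<longlonglongrightarrow> y"
      by (auto simp: closure_sequential)
    have "(\<lambda>n. T (s n)) \<longlonglongrightarrow> T y"
      using s \<open>y \<in> C\<close>
      by (intro continuous_on_tendsto_compose[OF cesaro_equicontinuous_on_imp_continuous_on[OF equi]])
        (auto simp: K_def)
    then have lim: "(\<lambda>n. norm (T (s n) - s n)) \<longlonglongrightarrow> norm (T y - y)"
      using s(2) by (intro tendsto_intros)
    have "norm (T (s n) - s n) \<le> e" for n
      using s(1) by (simp add: K_def)
    then show ?thesis by (intro LIMSEQ_le_const2[OF lim]) simp
  qed
  then have "norm (T y - y) \<le> 0" by (rule field_le_epsilon) simp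
  then show ?thesis by simp
qed

theorem theorem3p3:
  fixes C :: "'a::banach set" and T :: "'a \<Rightarrow> 'a" and x y :: 'a
  assumes "bounded C" and "convex C" and "x \<in> C" and "y \<in> C"
    and "T \<in> C \<rightarrow> C"
    and "affine_map_on C T"
    and "cesaro_equicontinuous_on C T"
  shows "((T y = y \<and> y \<in> closure (convex hull range (\<lambda>n. (T ^^ n) x))) \<longleftrightarrow>
        (\<lambda>n. cesaro_mean T (Suc n) x) \<longlonglongrightarrow> y)
    \<and> ((\<lambda>n. cesaro_mean T (Suc n) x) \<longlonglongrightarrow> y \<longleftrightarrow>
        weakly_converges_to (\<lambda>n. cesaro_mean T (Suc n) x) y)
    \<and> (weakly_converges_to (\<lambda>n. cesaro_mean T (Suc n) x) y \<longleftrightarrow>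
        (\<exists>r::nat \<Rightarrow> nat. strict_mono r \<and> weakly_converges_to (\<lambda>n. cesaro_mean T (Suc (r n)) x) y))"
    (is "(?i \<longleftrightarrow> ?ii) \<and> (?ii \<longleftrightarrow> ?iii) \<and> (?iii \<longleftrightarrow> ?iv)")
proof -
  \<comment> \<open>The implications form the cycle (i), (ii), (iii), (iv), (i). \<open>Suc\<close>
    makes each sequence start at the mean of length 1.\<close>
  have "?ii" if "?i"
    using that cesaro_mean_converges_to_fixed_point[OF assms] by blast
  moreover have "?iii" if "?ii"
    using that bounded_linear.tendsto by (auto simp: weakly_converges_to_def)
  moreover have "?iv" if "?iii"
    using that strict_mono_id by (intro exI[of _ id]) simp
  moreover have "?i" if "?iv"
  proof -
    from that obtain r where r: "strict_mono r"
      "weakly_converges_to (\<lambda>n. cesaro_mean T (Suc (r n)) x) y" by blast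
    \<comment> \<open>Every mean of \<open>x\<close> lies in the convex hull of the orbit, so
      Mazur's theorem puts the weak limit in its norm closure.\<close>
    have "cesaro_mean T (Suc n) x \<in> convex hull range (\<lambda>n. (T ^^ n) x)" for n
      by (intro cesaro_mean_mem convex_convex_hull) (auto intro: hull_inc)
    then have "y \<in> closure (convex hull range (\<lambda>n. (T ^^ n) x))"
      using r(2) by (intro Mazur_weak_limit_in_closure[OF convex_convex_hull]) auto
    with weak_cluster_point_of_cesaro_means_fixed[OF assms r] show ?thesis by blast
  qed
  ultimately show ?thesis by blast
qed

end
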